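(* The limit scheme for the 1-to-1 network with its coupling data (as defined in the context) is conservative at the coupling node. It is further conservative over the full real line in the case $f_1(0)=f_2(0)$, and it is conservative over bounded domains if zero-flux boundary conditions are imposed.
   Context: Let $\Delta x,\Delta t>0$, $\lambda_1,\lambda_2>0$ (not necessarily equal), and let $f_1,f_2:\mathbb{R}\to\mathbb{R}$ be smooth. The unknowns are $u_j^n\in\mathbb{R}$ for $j\in\mathbb{Z}$, $n\in\mathbb{N}_0$; on the full real line the initial data are compactly supported, i.e. $u_j^0=0$ for all but finitely many $j$. The coupling node is located at the interface between cells $j=-1$ and $j=0$. **Limit scheme for the 1-to-1 network.** It approximates $\partial_tu+\partial_xf_1(u)=0$ on $(-\infty,0)$ coupled to $\partial_tu+\partial_xf_2(u)=0$ on $(0,\infty)$. For $j\in\mathbb{Z}\setminus\{-1,0\}$, with $\alpha(j)=1$ for $j<0$ and $\alpha(j)=2$ for $j>0$, $$u^{n+1}_j=u^n_j-\frac{\Delta t}{2\Delta x}\left(f_{\alpha(j)}(u^n_{j+1})-f_{\alpha(j)}(u^n_{j-1})\right)+\frac{\lambda_{\alpha(j)}\Delta t}{2\Delta x}\left(u^n_{j+1}-2u^n_j+u^n_{j-1}\right),$$ and next to the node $$u^{n+1}_{-1}=u^n_{-1}-\frac{\Delta t}{2\Delta x}\left(v^n_R-f_1(u^n_{-2})\right)+\frac{\lambda_1\Delta t}{2\Delta x}\left(u^n_R-2u^n_{-1}+u^n_{-2}\right),$$ $$u^{n+1}_0=u^n_0-\frac{\Delta t}{2\Delta x}\left(f_2(u^n_1)-v^n_L\right)+\frac{\lambda_2\Delta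 t}{2\Delta x}\left(u^n_1-2u^n_0+u^n_L\right).$$ **Coupling data.** $$u^n_R=\frac{\lambda_2}{\lambda_1}\,\frac{\lambda_1u^n_{-1}+\lambda_2u^n_0+f_1(u^n_{-1})-f_2(u^n_0)}{\lambda_1+\lambda_2},\qquad u^n_L=\frac{\lambda_1}{\lambda_2}\,\frac{\lambda_1u^n_{-1}+\lambda_2u^n_0+f_1(u^n_{-1})-f_2(u^n_0)}{\lambda_1+\lambda_2},$$ $$v^n_R=v^n_L=\frac{\lambda_1f_1(u^n_{-1})+\lambda_2f_2(u^n_0)+\lambda_1^2u^n_{-1}-\lambda_2^2u^n_0}{\lambda_1+\lambda_2}.$$ **Numerical fluxes.** The scheme is written edge by edge as $u_j^{n+1}=u_j^n-\frac{\Delta t}{\Delta x}(F_{j+1/2}^n-F_{j-1/2}^n)$ with $$F_{j-1/2}^n=\tfrac12(f_1(u_{j-1}^n)+f_1(u_j^n))-\tfrac{\lambda_1}2(u_j^n-u_{j-1}^n)\quad\text{for } j<0,$$ $$F_{j-1/2}^n=\tfrac12(f_2(u_{j-1}^n)+f_2(u_j^n))-\tfrac{\lambda_2}2(u_j^n-u_{j-1}^n)\quad\text{for } j>0.$$ At the node, the flux out of the incoming edge (used as $F_{-1/2}^n$ in the update of cell $-1$) is $$F^{1,n}_{-1/2}=\tfrac12(v_R^n+f_1(u_{-1}^n))-\tfrac{\lambda_1}2(u_R^n-u_{-1}^n),$$ and the flux into the outgoing edge (used as $F_{-1/2}^n$ in the update of cell $0$) is $$F^{2,n}_{-1/2}=\tfrac12(f_2(u_0^n)+v_L^n)-\tfrac{\lambda_2}2(u_0^n-u_L^n).$$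 **Notions of conservation.** - *Conservative at the coupling node*: $F^{1,n}_{-1/2}=F^{2,n}_{-1/2}$ for all $n\in\mathbb{N}_0$. - *Conservative over the full real line*: the total mass $\sum_{j\in\mathbb{Z}}u_j^n$ is independent of $n$. - *Conservative over bounded domains with zero-flux boundary conditions*: if only finitely many cells $-M\le j\le K-1$ (with integers $M,K\ge1$) are considered and the numerical fluxes at the two outer boundaries, $F^n_{-M-1/2}$ and $F^n_{K-1/2}$, are replaced by $0$, then $\sum_{j=-M}^{K-1}u_j^n$ is independent of $n$. *)

theory Defs
  imports "HOL-Analysis.Analysis"
begin

text \<open>A grid function \<open>w :: int \<Rightarrow> real\<close> is the state at a single time level and
  \<open>u :: nat \<Rightarrow> int \<Rightarrow> real\<close> is the evolution, i.e. \<open>u n j\<close> is $u_j^n$. The parameters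
  \<open>l1, l2, f1, f2\<close> are the relaxation speeds and the flux functions of the incoming edge
  (cells \<open>j < 0\<close>) and of the outgoing edge (cells \<open>j \<ge> 0\<close>).\<close>

definition smooth_real :: "(real \<Rightarrow> real) \<Rightarrow> bool" where
  "smooth_real f \<longleftrightarrow> (\<forall>k x. (deriv ^^ k) f field_differentiable at x)"

definition coupling_uR ::
  "real \<Rightarrow> real \<Rightarrow> (real \<Rightarrow> real) \<Rightarrow> (real \<Rightarrow> real) \<Rightarrow> (int \<Rightarrow> real) \<Rightarrow> real" where
  "coupling_uR l1 l2 f1 f2 w =
     (l2 / l1) * ((l1 * w (-1) + l2 * w 0 + f1 (w (-1)) - f2 (w 0)) / (l1 + l2))"

definition coupling_uL ::
  "real \<Rightarrow> real \<Rightarrow> (real \<Rightarrow> real) \<Rightarrow> (real \<Rightarrow> real) \<Rightarrow> (int \<Rightarrow> real) \<Rightarrow> real" where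
  "coupling_uL l1 l2 f1 f2 w =
     (l1 / l2) * ((l1 * w (-1) + l2 * w 0 + f1 (w (-1)) - f2 (w 0)) / (l1 + l2))"

text \<open>The common value of $v_R$ and $v_L$.\<close>

definition coupling_v ::
  "real \<Rightarrow> real \<Rightarrow> (real \<Rightarrow> real) \<Rightarrow> (real \<Rightarrow> real) \<Rightarrow> (int \<Rightarrow> real) \<Rightarrow> real" where
  "coupling_v l1 l2 f1 f2 w =
     (l1 * f1 (w (-1)) + l2 * f2 (w 0) + l1\<^sup>2 * w (-1) - l2\<^sup>2 * w 0) / (l1 + l2)"

definition edge_update ::
  "real \<Rightarrow> real \<Rightarrow> real \<Rightarrow> (real \<Rightarrow> real) \<Rightarrow> (int \<Rightarrow> real) \<Rightarrow> int \<Rightarrow> real" where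
  "edge_update dx dt l f w j =
     w j - dt / (2 * dx) * (f (w (j + 1)) - f (w (j - 1)))
         + l * dt / (2 * dx) * (w (j + 1) - 2 * w j + w (j - 1))"

definition limit_scheme ::
  "real \<Rightarrow> real \<Rightarrow> real \<Rightarrow> real \<Rightarrow> (real \<Rightarrow> real) \<Rightarrow> (real \<Rightarrow> real) \<Rightarrow> (nat \<Rightarrow> int \<Rightarrow> real) \<Rightarrow> bool" where
  "limit_scheme dx dt l1 l2 f1 f2 u \<longleftrightarrow>
     (\<forall>n.
       (\<forall>j < -1. u (Suc n) j = edge_update dx dt l1 f1 (u n) j) \<and>
       (\<forall>j > 0. u (Suc n) j = edge_update dx dt l2 f2 (u n) j) \<and>
       u (Suc n) (-1) = u n (-1)
         - dt / (2 * dx) * (coupling_v l1 l2 f1 f2 (u n) - f1 (u n (-2)))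
         + l1 * dt / (2 * dx) * (coupling_uR l1 l2 f1 f2 (u n) - 2 * u n (-1) + u n (-2)) \<and>
       u (Suc n) 0 = u n 0
         - dt / (2 * dx) * (f2 (u n 1) - coupling_v l1 l2 f1 f2 (u n))
         + l2 * dt / (2 * dx) * (u n 1 - 2 * u n 0 + coupling_uL l1 l2 f1 f2 (u n)))"

text \<open>The value at \<open>j\<close> is the flux $F_{j-1/2}$ at the left interface of cell \<open>j\<close>; it is meant
  for \<open>j \<noteq> 0\<close> only, as the interface $-1/2$ is the coupling node and carries the two node
  fluxes below.\<close>

definition interior_flux ::
  "real \<Rightarrow> real \<Rightarrow> (real \<Rightarrow> real) \<Rightarrow> (real \<Rightarrow> real) \<Rightarrow> (int \<Rightarrow> real) \<Rightarrow> int \<Rightarrow> real" where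
  "interior_flux l1 l2 f1 f2 w j =
     (if j < 0 then 1/2 * (f1 (w (j - 1)) + f1 (w j)) - l1 / 2 * (w j - w (j - 1))
      else 1/2 * (f2 (w (j - 1)) + f2 (w j)) - l2 / 2 * (w j - w (j - 1)))"

definition node_flux_out ::
  "real \<Rightarrow> real \<Rightarrow> (real \<Rightarrow> real) \<Rightarrow> (real \<Rightarrow> real) \<Rightarrow> (int \<Rightarrow> real) \<Rightarrow> real" where
  "node_flux_out l1 l2 f1 f2 w =
     1/2 * (coupling_v l1 l2 f1 f2 w + f1 (w (-1))) - l1 / 2 * (coupling_uR l1 l2 f1 f2 w - w (-1))"

definition node_flux_in ::
  "real \<Rightarrow> real \<Rightarrow> (real \<Rightarrow> real) \<Rightarrow> (real \<Rightarrow> real) \<Rightarrow> (int \<Rightarrow> real) \<Rightarrow> real" where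
  "node_flux_in l1 l2 f1 f2 w =
     1/2 * (f2 (w 0) + coupling_v l1 l2 f1 f2 w) - l2 / 2 * (w 0 - coupling_uL l1 l2 f1 f2 w)"

definition left_flux ::
  "real \<Rightarrow> real \<Rightarrow> (real \<Rightarrow> real) \<Rightarrow> (real \<Rightarrow> real) \<Rightarrow> (int \<Rightarrow> real) \<Rightarrow> int \<Rightarrow> real" where
  "left_flux l1 l2 f1 f2 w j =
     (if j = 0 then node_flux_in l1 l2 f1 f2 w else interior_flux l1 l2 f1 f2 w j)"

definition right_flux ::
  "real \<Rightarrow> real \<Rightarrow> (real \<Rightarrow> real) \<Rightarrow> (real \<Rightarrow> real) \<Rightarrow> (int \<Rightarrow> real) \<Rightarrow> int \<Rightarrow> real" where
  "right_flux l1 l2 f1 f2 w j =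
     (if j = -1 then node_flux_out l1 l2 f1 f2 w else interior_flux l1 l2 f1 f2 w (j + 1))"

text \<open>The explicit update formulas agree with the flux form on every cell.\<close>

lemma limit_scheme_flux_form:
  assumes "dx > 0"
  shows "limit_scheme dx dt l1 l2 f1 f2 u \<longleftrightarrow>
     (\<forall>n j. u (Suc n) j =
        u n j - dt / dx * (right_flux l1 l2 f1 f2 (u n) j - left_flux l1 l2 f1 f2 (u n) j))"
    (is "_ \<longleftrightarrow> (\<forall>n j. u (Suc n) j = ?G n j)")
proof -
  have a: "edge_update dx dt l1 f1 (u n) j = ?G n j" if "j < -1" for n j
    using that assms
    by (simp add: edge_update_def right_flux_def left_flux_def interior_flux_def field_simps)
  have b: "edge_update dx dt l2 f2 (u n) j = ?G n j" if "j > 0" for n j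
    using that assms
    by (simp add: edge_update_def right_flux_def left_flux_def interior_flux_def field_simps)
  have c: "u n (-1)
         - dt / (2 * dx) * (coupling_v l1 l2 f1 f2 (u n) - f1 (u n (-2)))
         + l1 * dt / (2 * dx) * (coupling_uR l1 l2 f1 f2 (u n) - 2 * u n (-1) + u n (-2))
      = ?G n (-1)" for n
    using assms
    by (simp add: right_flux_def left_flux_def interior_flux_def node_flux_out_def field_simps)
  have d: "u n 0
         - dt / (2 * dx) * (f2 (u n 1) - coupling_v l1 l2 f1 f2 (u n))
         + l2 * dt / (2 * dx) * (u n 1 - 2 * u n 0 + coupling_uL l1 l2 f1 f2 (u n))
      = ?G n 0" for n
    using assms
    by (simp add: right_flux_def left_flux_def interior_flux_def node_flux_in_def field_simps)
  have split: "(\<forall>j. P j) \<longleftrightarrow> (\<forall>j < -1. P j) \<and> (\<forall>j > 0. P j) \<and> P (-1) \<and> P 0"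
    for P :: "int \<Rightarrow> bool"
  proof -
    have "j < -1 \<or> j > 0 \<or> j = -1 \<or> j = 0" for j :: int
      by arith
    then show ?thesis
      by metis
  qed
  show ?thesis
    unfolding limit_scheme_def c d using a b by (subst split) simp
qed

text \<open>The scheme on the cells $-M \le j \le K-1$ with the fluxes at the outer boundaries
  replaced by 0. Values of \<open>u\<close> outside these cells are unconstrained and enter none of the
  equations.\<close>

definition zero_flux_scheme ::
  "real \<Rightarrow> real \<Rightarrow> real \<Rightarrow> real \<Rightarrow> (real \<Rightarrow> real) \<Rightarrow> (real \<Rightarrow> real) \<Rightarrow> int \<Rightarrow> int \<Rightarrow>
   (nat \<Rightarrow> int \<Rightarrow> real) \<Rightarrow> bool" where
  "zero_flux_scheme dx dt l1 l2 f1 f2 M K u \<longleftrightarrow>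
     (\<forall>n. \<forall>j\<in>{-M..K - 1}. u (Suc n) j = u n j - dt / dx *
        ((if j = K - 1 then 0 else right_flux l1 l2 f1 f2 (u n) j)
         - (if j = -M then 0 else left_flux l1 l2 f1 f2 (u n) j)))"

definition conservative_at_node ::
  "real \<Rightarrow> real \<Rightarrow> (real \<Rightarrow> real) \<Rightarrow> (real \<Rightarrow> real) \<Rightarrow> (nat \<Rightarrow> int \<Rightarrow> real) \<Rightarrow> bool" where
  "conservative_at_node l1 l2 f1 f2 u \<longleftrightarrow>
     (\<forall>n. node_flux_out l1 l2 f1 f2 (u n) = node_flux_in l1 l2 f1 f2 (u n))"

text \<open>Summability is demanded explicitly, since \<open>infsum\<close> is 0 on non-summable families.\<close>

definition conservative_full_line :: "(nat \<Rightarrow> int \<Rightarrow> real) \<Rightarrow> bool" where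
  "conservative_full_line u \<longleftrightarrow>
     (\<forall>n. u n summable_on UNIV) \<and> (\<forall>m n. infsum (u m) UNIV = infsum (u n) UNIV)"

definition conservative_on_cells :: "int \<Rightarrow> int \<Rightarrow> (nat \<Rightarrow> int \<Rightarrow> real) \<Rightarrow> bool" where
  "conservative_on_cells M K u \<longleftrightarrow>
     (\<forall>m n. (\<Sum>j\<in>{-M..K - 1}. u m j) = (\<Sum>j\<in>{-M..K - 1}. u n j))"

end

theory Submission
  imports Defs
begin

text \<open>The scheme is an update by flux differences, so the mass of a block of cells changes only
  through the fluxes at its two ends, provided that neighbouring cells agree on the flux through
  their common interface. Away from the node they agree by definition. At the node this is
  a property of the coupling data: with
  $A = (\lambda_1 u_{-1} + \lambda_2 u_0 + f_1(u_{-1}) - f_2(u_0)) / (\lambda_1 + \lambda_2)$ one has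
  $\lambda_1 u_R = \lambda_2 A$ and $\lambda_2 u_L = \lambda_1 A$, so that, as $v_R = v_L$, twice
  the difference of the two node fluxes is
  $\lambda_1 u_{-1} + \lambda_2 u_0 + f_1(u_{-1}) - f_2(u_0) - (\lambda_1 + \lambda_2) A = 0$
  (\<open>node_fluxes_agree\<close>). Hence the fluxes telescope across the node as well.

  On a bounded domain both end fluxes are replaced by 0. On the full line the data stay
  compactly supported, because the stencil reaches only one cell to either side; at the ends of
  an interval that contains the support the fluxes are $f_1(0)$ and $f_2(0)$, and they cancel when
  these values are equal.\<close>

lemma node_fluxes_agree:
  fixes l1 l2 :: real
  assumes "l1 > 0" "l2 > 0"
  shows "node_flux_out l1 l2 f1 f2 w = node_flux_in l1 l2 f1 f2 w"
proof -
  define A where "A = (l1 * w (-1) + l2 * w 0 + f1 (w (-1)) - f2 (w 0)) / (l1 + l2)"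
  have A: "(l1 + l2) * A = l1 * w (-1) + l2 * w 0 + f1 (w (-1)) - f2 (w 0)"
    using assms by (simp add: A_def)
  have uR: "l1 * coupling_uR l1 l2 f1 f2 w = l2 * A"
    and uL: "l2 * coupling_uL l1 l2 f1 f2 w = l1 * A"
    using assms by (simp_all add: coupling_uR_def coupling_uL_def A_def)
  have "2 * node_flux_out l1 l2 f1 f2 w =
      coupling_v l1 l2 f1 f2 w + f1 (w (-1)) - l2 * A + l1 * w (-1)"
    unfolding uR[symmetric] by (simp add: node_flux_out_def algebra_simps)
  moreover have "2 * node_flux_in l1 l2 f1 f2 w =
      coupling_v l1 l2 f1 f2 w + f2 (w 0) - l2 * w 0 + l1 * A"
    unfolding uL[symmetric] by (simp add: node_flux_in_def algebra_simps)
  ultimately show ?thesis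
    using A by (simp add: algebra_simps)
qed

lemma right_flux_eq_left_flux:
  assumes "l1 > 0" "l2 > 0"
  shows "right_flux l1 l2 f1 f2 w j = left_flux l1 l2 f1 f2 w (j + 1)"
  using node_fluxes_agree[OF assms] by (auto simp: right_flux_def left_flux_def)

lemma sum_int_telescope:
  fixes H :: "int \<Rightarrow> real"
  assumes "a \<le> b"
  shows "(\<Sum>j\<in>{a..b}. H (j + 1) - H j) = H (b + 1) - H a"
  using assms
proof (induction b rule: int_ge_induct)
  case base
  show ?case by simp
next
  case (step b)
  have "{a..b + 1} = insert (b + 1) {a..b}"
    using step.hyps by auto
  then show ?case
    using step.IH by simp
qed

lemma mass_balance:
  fixes v w H :: "int \<Rightarrow> real"
  assumes "a \<le> b" and "\<And>j. j \<in> {a..b} \<Longrightarrow> v j = w j - c * (H (j + 1) - H j)"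
  shows "(\<Sum>j\<in>{a..b}. v j) = (\<Sum>j\<in>{a..b}. w j) - c * (H (b + 1) - H a)"
proof -
  have "(\<Sum>j\<in>{a..b}. v j) = (\<Sum>j\<in>{a..b}. w j - c * (H (j + 1) - H j))"
    using assms(2) by (rule sum.cong[OF refl])
  also have "\<dots> = (\<Sum>j\<in>{a..b}. w j) - c * (\<Sum>j\<in>{a..b}. H (j + 1) - H j)"
    by (simp only: sum_subtractf[where f = w] sum_distrib_left)
  finally show ?thesis
    by (simp only: sum_int_telescope[OF assms(1)])
qed

lemma limit_scheme_step:
  assumes "dx > 0" "l1 > 0" "l2 > 0" "limit_scheme dx dt l1 l2 f1 f2 u"
  shows "u (Suc n) j =
    u n j - dt / dx * (left_flux l1 l2 f1 f2 (u n) (j + 1) - left_flux l1 l2 f1 f2 (u n) j)"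
  using assms(4) limit_scheme_flux_form[OF assms(1)] right_flux_eq_left_flux[OF assms(2,3)]
  by simp

lemma left_flux_vacuum:
  assumes "f1 0 = f2 0" "j \<noteq> 0" "w (j - 1) = 0" "w j = 0"
  shows "left_flux l1 l2 f1 f2 w j = f1 0"
  using assms by (simp add: left_flux_def interior_flux_def)

text \<open>Growing the interval by one cell on either side accounts for the width of the stencil, and
  it also places both ends of the larger interval between vacuum cells, where the fluxes are
  equal. The bound \<open>N \<ge> 0\<close> keeps the node away from these ends.\<close>

lemma limit_scheme_support_step:
  fixes N :: int
  assumes pos: "dx > 0" "l1 > 0" "l2 > 0"
    and scheme: "limit_scheme dx dt l1 l2 f1 f2 u"
    and f0: "f1 0 = f2 0"
    and N: "N \<ge> 0"
    and supp: "\<And>j. j \<notin> {-N..N} \<Longrightarrow> u n j = 0"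
  shows "j \<notin> {-(N + 1)..N + 1} \<Longrightarrow> u (Suc n) j = 0"
    and "(\<Sum>j\<in>{-(N + 1)..N + 1}. u (Suc n) j) = (\<Sum>j\<in>{-(N + 1)..N + 1}. u n j)"
proof -
  let ?F = "left_flux l1 l2 f1 f2 (u n)"
  have F: "?F j = f1 0" if "j \<le> -(N + 1) \<or> j \<ge> N + 2" for j
    using that N by (intro left_flux_vacuum f0 supp) auto
  note step = limit_scheme_step[OF pos scheme]
  show "u (Suc n) j = 0" if "j \<notin> {-(N + 1)..N + 1}"
    using that N supp[of j] F[of j] F[of "j + 1"] step[of n j] by auto
  have "(\<Sum>j\<in>{-(N + 1)..N + 1}. u (Suc n) j) =
      (\<Sum>j\<in>{-(N + 1)..N + 1}. u n j) - dt / dx * (?F (N + 1 + 1) - ?F (-(N + 1)))"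
    using N by (intro mass_balance step) simp
  then show "(\<Sum>j\<in>{-(N + 1)..N + 1}. u (Suc n) j) = (\<Sum>j\<in>{-(N + 1)..N + 1}. u n j)"
    using F[of "N + 1 + 1"] F[of "-(N + 1)"] by simp
qed

lemma infsum_finite_support:
  fixes w :: "int \<Rightarrow> real"
  assumes "finite S" "\<And>j. j \<notin> S \<Longrightarrow> w j = 0"
  shows "w summable_on UNIV" "infsum w UNIV = (\<Sum>j\<in>S. w j)"
proof -
  have "w summable_on UNIV \<longleftrightarrow> w summable_on S"
    using assms(2) by (intro summable_on_cong_neutral) auto
  then show "w summable_on UNIV"
    using assms(1) by simp
  have "infsum w UNIV = infsum w S"
    using assms(2) by (intro infsum_cong_neutral) auto
  then show "infsum w UNIV = (\<Sum>j\<in>S. w j)"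
    using assms(1) by simp
qed

lemma limit_scheme_conservative_full_line:
  assumes pos: "dx > 0" "l1 > 0" "l2 > 0"
    and scheme: "limit_scheme dx dt l1 l2 f1 f2 u"
    and f0: "f1 0 = f2 0"
    and fin: "finite {j. u 0 j \<noteq> 0}"
  shows "conservative_full_line u"
proof -
  note step = limit_scheme_support_step[OF pos scheme f0]
  have supp: "\<exists>N\<ge>0. \<forall>j. j \<notin> {-N..N} \<longrightarrow> u n j = 0" for n
  proof (induction n)
    case 0
    let ?A = "insert 0 (abs ` {j. u 0 j \<noteq> 0})"
    have "\<bar>j\<bar> \<le> Max ?A" if "u 0 j \<noteq> 0" for j
      using fin that by (intro Max_ge) auto
    moreover have "0 \<le> Max ?A"
      using fin by (intro Max_ge) auto
    ultimately show ?case
      by (intro exI[of _ "Max ?A"]) (force simp: abs_le_iff)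
  next
    case (Suc n)
    then obtain N where N: "N \<ge> 0" "\<And>j. j \<notin> {-N..N} \<Longrightarrow> u n j = 0"
      by blast
    have "u (Suc n) j = 0" if "j \<notin> {-(N + 1)..N + 1}" for j
      using step(1)[OF N that] .
    then show ?case
      using N(1) by (intro exI[of _ "N + 1"]) auto
  qed
  have mass: "u n summable_on UNIV \<and> infsum (u (Suc n)) UNIV = infsum (u n) UNIV" for n
  proof -
    obtain N where N: "N \<ge> 0" "\<And>j. j \<notin> {-N..N} \<Longrightarrow> u n j = 0"
      using supp by blast
    let ?S = "{-(N + 1)..N + 1}"
    have now: "u n j = 0" if "j \<notin> ?S" for j
      using that N(2)[of j] by auto
    have "infsum (u (Suc n)) UNIV = (\<Sum>j\<in>?S. u (Suc n) j)"
      using step(1)[OF N] by (intro infsum_finite_support) auto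
    also have "\<dots> = (\<Sum>j\<in>?S. u n j)"
      by (rule step(2)[OF N])
    also have "\<dots> = infsum (u n) UNIV"
      using now by (intro infsum_finite_support(2)[symmetric]) auto
    finally show ?thesis
      using infsum_finite_support(1)[of ?S "u n"] now by auto
  qed
  have "infsum (u n) UNIV = infsum (u 0) UNIV" for n
    by (induction n) (use mass in auto)
  then show ?thesis
    unfolding conservative_full_line_def using mass by metis
qed

lemma zero_flux_scheme_conservative:
  assumes pos: "l1 > 0" "l2 > 0"
    and MK: "M \<ge> 1" "K \<ge> 1"
    and scheme: "zero_flux_scheme dx dt l1 l2 f1 f2 M K u"
  shows "conservative_on_cells M K u"
proof -
  have step: "(\<Sum>j\<in>{-M..K - 1}. u (Suc n) j) = (\<Sum>j\<in>{-M..K - 1}. u n j)" for n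
  proof -
    \<comment> \<open>Indexed by left interfaces, the outer boundaries of the domain are \<open>-M\<close> and \<open>K\<close>.\<close>
    define H where "H j = (if j = -M \<or> j = K then 0 else left_flux l1 l2 f1 f2 (u n) j)" for j
    have "u (Suc n) j = u n j - dt / dx * (H (j + 1) - H j)" if "j \<in> {-M..K - 1}" for j
      using scheme that
      by (auto simp: zero_flux_scheme_def H_def right_flux_eq_left_flux[OF pos])
    then have "(\<Sum>j\<in>{-M..K - 1}. u (Suc n) j) =
        (\<Sum>j\<in>{-M..K - 1}. u n j) - dt / dx * (H (K - 1 + 1) - H (-M))"
      using MK by (intro mass_balance) auto
    then show ?thesis
      by (simp add: H_def)
  qed
  have "(\<Sum>j\<in>{-M..K - 1}. u n j) = (\<Sum>j\<in>{-M..K - 1}. u 0 j)" for n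
    by (induction n) (use step in auto)
  then show ?thesis
    unfolding conservative_on_cells_def by metis
qed

theorem corollary1:
  fixes dx dt l1 l2 :: real and f1 f2 :: "real \<Rightarrow> real"
  assumes "dx > 0" and "dt > 0" and "l1 > 0" and "l2 > 0"
    and "smooth_real f1" and "smooth_real f2"
  shows
    "(\<forall>u. limit_scheme dx dt l1 l2 f1 f2 u \<longrightarrow> conservative_at_node l1 l2 f1 f2 u) \<and>
     (f1 0 = f2 0 \<longrightarrow>
        (\<forall>u. limit_scheme dx dt l1 l2 f1 f2 u \<and> finite {j. u 0 j \<noteq> 0}
           \<longrightarrow> conservative_full_line u)) \<and>
     (\<forall>M K u. M \<ge> 1 \<and> K \<ge> 1 \<and> zero_flux_scheme dx dt l1 l2 f1 f2 M K u
           \<longrightarrow> conservative_on_cells M K u)"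
  using node_fluxes_agree[OF assms(3,4)]
    limit_scheme_conservative_full_line[OF assms(1,3,4)]
    zero_flux_scheme_conservative[OF assms(3,4)]
  unfolding conservative_at_node_def by blast

end
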